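(* Let $n\ge1$ and let $K\subset\mathbb{R}^n$ be a convex body with barycenter $b(K)=0$. Then there exist $A\in GL(n,\mathbb{R})$, $r>0$ and $a\in AK$ such that $$B_2^n(a,r)\subset AK\subset B_2^n(0,2nr)\qquad\text{and}\qquad (AK)^\circ\subset B_2^n(0,2n/r).$$
   Context: A convex body in $\mathbb{R}^n$ is a compact convex set with non-empty interior. The barycenter is $b(K)=\frac1{|K|}\int_Kx\,dx$, with $|K|$ the Lebesgue measure of $K$. $B_2^n(x,\rho)$ is the closed Euclidean ball in $\mathbb{R}^n$ with center $x$ and radius $\rho$. The polar of $L\subset\mathbb{R}^n$ is $L^\circ=\{y\in\mathbb{R}^n:\langle x,y\rangle\le1\text{ for all }x\in L\}$. *)

theory Defs
  imports "HOL-Analysis.Analysis"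
begin

definition convex_body :: "'a::euclidean_space set \<Rightarrow> bool" where
  "convex_body K \<longleftrightarrow> compact K \<and> convex K \<and> interior K \<noteq> {}"

definition barycenter :: "'a::euclidean_space set \<Rightarrow> 'a" where
  "barycenter K = (1 / measure lebesgue K) *\<^sub>R (LINT x:K|lebesgue. x)"

definition polar :: "'a::real_inner set \<Rightarrow> 'a set" where
  "polar L = {y. \<forall>x\<in>L. x \<bullet> y \<le> 1}"

end

theory Submission
  imports Defs
begin

text \<open>
  Two classical facts carry the proof.

  The first is John's theorem: if the unit ball is an ellipsoid of maximal volume inside a convex
  body \<open>L\<close>, then \<open>L\<close> lies in the concentric ball of radius \<open>n\<close>. For otherwise \<open>L\<close> contains a point
  at distance \<open>t > n\<close> from the centre, hence also the convex hull of the ball and that point;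
  stretching the ball slightly towards the point and flattening it slightly in the orthogonal
  directions yields an ellipsoid in this hull (\<open>stretched_ball_subset\<close>), and the condition \<open>t > n\<close> is
  exactly what makes its volume larger (\<open>stretching_gains_volume\<close>). A maximal ellipsoid exists by
  compactness of the set of all pairs (matrix, centre) that parametrise ellipsoids in \<open>K\<close>
  (\<open>compact_inscribed_ellipsoids\<close>). So in suitable coordinates, given by an invertible matrix \<open>A\<close>,
  the image \<open>A K\<close> lies between the balls of radius \<open>1\<close> and \<open>n\<close> around some \<open>a\<close>.

  The second is the theorem of Minkowski and Radon on the asymmetry of a body about its barycenter:
  a linear functional that is at most \<open>M\<close> on a body with barycenter \<open>0\<close> is at least \<open>- n M\<close> there
  (\<open>barycenter_functional_lower_bound\<close>). It implies \<open>0 \<in> K\<close>, so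
  the norm of \<open>a\<close> is at most \<open>n\<close> and \<open>A K\<close> lies in the ball of radius \<open>2 n\<close> around \<open>0\<close>.
  It also bounds the polar: if \<open>y\<close> is in the polar of \<open>A K\<close>, the functional \<open>y\<close> is at most \<open>1\<close> on
  \<open>A K\<close>, hence at least \<open>- n\<close> at \<open>a\<close>; at the point of the unit ball around \<open>a\<close> that is farthest in
  the direction of \<open>y\<close> it exceeds its value at \<open>a\<close> by the norm of \<open>y\<close> and is still at most \<open>1\<close>.
  Hence the norm of \<open>y\<close> is at most \<open>n + 1 \<le> 2 n\<close>. Thus \<open>r = 1\<close> works.
\<close>

section \<open>Linear functionals on a body with barycenter zero\<close>

lemma integral_homothetic_image:
  fixes f :: "'a::euclidean_space \<Rightarrow> real"
  assumes "bounded K" and l: "l > 0"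
    and int: "f integrable_on (\<lambda>x. l *\<^sub>R x + c) ` K"
  shows "integral ((\<lambda>x. l *\<^sub>R x + c) ` K) f = l ^ DIM('a) * integral K (\<lambda>x. f (l *\<^sub>R x + c))"
proof -
  let ?h = "\<lambda>x. l *\<^sub>R x + c"
  define I where "I = integral (?h ` K) f"
  have "bounded (?h ` K)"
    using bounded_translation[OF bounded_scaling[OF assms(1)], of c l]
    by (simp add: image_image add.commute)
  then obtain b where b: "?h ` K \<subseteq> cbox (- b) b"
    using bounded_subset_cbox_symmetric by blast
  have "(f has_integral I) (?h ` K)"
    using int I_def by (simp add: integrable_integral)
  then have "((\<lambda>x. if x \<in> ?h ` K then f x else 0) has_integral I) (cbox (- b) b)"
    using has_integral_restrict[OF b] by blast
  from has_integral_affinity'[OF this l, of c]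
  have 1: "((\<lambda>x. if ?h x \<in> ?h ` K then f (?h x) else 0) has_integral I /\<^sub>R l ^ DIM('a))
      (cbox ((- b - c) /\<^sub>R l) ((b - c) /\<^sub>R l))" .
  have mem: "?h x \<in> ?h ` K \<longleftrightarrow> x \<in> K" for x
    using l by auto
  have sub: "K \<subseteq> cbox ((- b - c) /\<^sub>R l) ((b - c) /\<^sub>R l)"
  proof
    fix x assume "x \<in> K"
    then have "?h x \<in> cbox (- b) b" using b by auto
    then show "x \<in> cbox ((- b - c) /\<^sub>R l) ((b - c) /\<^sub>R l)"
      using l by (auto simp: mem_box inner_simps field_simps)
  qed
  from 1 have "((\<lambda>x. f (?h x)) has_integral I /\<^sub>R l ^ DIM('a)) K"
    unfolding mem using has_integral_restrict[OF sub] by blast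
  then have "integral K (\<lambda>x. f (?h x)) = I /\<^sub>R l ^ DIM('a)"
    by (rule integral_unique)
  then show ?thesis using l by (simp add: I_def)
qed

lemma convex_body_integrals:
  fixes K :: "'a::euclidean_space set"
  assumes K: "convex_body K" and b0: "barycenter K = 0"
  shows "measure lebesgue K > 0"
    and "((\<lambda>x. 1::real) has_integral measure lebesgue K) K"
    and "((\<lambda>x. u \<bullet> x) has_integral 0) K"
proof -
  have cK: "compact K" and vK: "convex K" and iK: "interior K \<noteq> {}"
    using K by (auto simp: convex_body_def)
  have lm: "K \<in> lmeasurable" using cK by (rule lmeasurable_compact)
  have "\<not> negligible K" using negligible_convex_interior[OF vK] iK by blast
  then show pos: "measure lebesgue K > 0"
    using negligible_iff_measure0[OF lm] by (simp add: zero_less_measure_iff)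
  show "((\<lambda>x. 1::real) has_integral measure lebesgue K) K"
    using lm by (simp add: has_integral_iff lmeasurable_iff_integrable_on lmeasure_integral)
  have "set_integrable lborel K (\<lambda>x. x)"
    unfolding set_integrable_def using cK by (intro borel_integrable_compact continuous_on_id)
  then have si: "set_integrable lebesgue K (\<lambda>x. x)"
    unfolding set_integrable_def using integrable_completion[of "\<lambda>x. indicator K x *\<^sub>R x" lborel]
      borel_measurable_integrable by blast
  have "integral K (\<lambda>x. x) = 0"
    using b0 pos set_lebesgue_integral_eq_integral(2)[OF si] by (simp add: barycenter_def)
  then have "((\<lambda>x. x) has_integral 0) K"
    using set_lebesgue_integral_eq_integral(1)[OF si] integrable_integral by fastforce
  from has_integral_linear[OF this bounded_linear_inner_right[of u]]
  show "((\<lambda>x. u \<bullet> x) has_integral 0) K" by (simp add: o_def)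
qed

text \<open>
  For \<open>0 < l < 1\<close> shrink \<open>K\<close> towards \<open>p\<close> by the factor \<open>l\<close>. The nonnegative function
  \<open>M - u \<bullet> x\<close> has a smaller integral over the shrunken body, and both integrals are explicit since
  \<open>u \<bullet> x\<close> integrates to \<open>0\<close> over \<open>K\<close>. The resulting inequality is an equality at \<open>l = 1\<close>; the claim is its
  derivative there, obtained by cancelling the factor \<open>1 - l\<close> and letting \<open>l\<close> tend to \<open>1\<close>.
\<close>

lemma barycenter_functional_lower_bound:
  fixes K :: "'a::euclidean_space set"
  assumes K: "convex_body K" and b0: "barycenter K = 0"
    and p: "p \<in> K" and M: "\<And>x. x \<in> K \<Longrightarrow> u \<bullet> x \<le> M"
  shows "- (real DIM('a) * M) \<le> u \<bullet> p"
proof -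
  let ?n = "DIM('a)"
  define V where "V = measure lebesgue K"
  have cK: "compact K" and vK: "convex K"
    using K by (auto simp: convex_body_def)
  have V: "V > 0" and one: "((\<lambda>x. 1::real) has_integral V) K"
    and lin: "((\<lambda>x. u \<bullet> x) has_integral 0) K"
    using convex_body_integrals[OF K b0] by (auto simp: V_def)
  have main: "- (u \<bullet> p) * l ^ ?n \<le> M * (\<Sum>i<?n. l ^ i)" if l: "0 < l" "l < 1" for l
  proof -
    let ?h = "\<lambda>x. l *\<^sub>R x + (1 - l) *\<^sub>R p"
    let ?g = "\<lambda>x. M - u \<bullet> x"
    have sub: "?h ` K \<subseteq> K"
      using vK p l by (auto intro!: convexD)
    have ch: "compact (?h ` K)"
      by (intro compact_continuous_image continuous_intros cK)
    have gint: "?g integrable_on S" if "compact S" for S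
    proof -
      have "set_integrable lborel S ?g"
        unfolding set_integrable_def using that by (intro borel_integrable_compact continuous_intros)
      then show ?thesis by (rule set_borel_integral_eq_integral(1))
    qed
    have gK: "integral K ?g = M * V"
      using has_integral_diff[OF has_integral_cmul[OF one, of M] lin] by (simp add: integral_unique)
    have "((\<lambda>x. (M - (1 - l) * (u \<bullet> p)) *\<^sub>R 1 - l *\<^sub>R (u \<bullet> x)) has_integral
        (M - (1 - l) * (u \<bullet> p)) *\<^sub>R V - l *\<^sub>R 0) K"
      by (intro has_integral_diff has_integral_cmul one lin)
    then have gh: "integral K (\<lambda>x. ?g (?h x)) = (M - (1 - l) * (u \<bullet> p)) * V"
      by (intro integral_unique) (simp add: inner_simps algebra_simps)
    have "l ^ ?n * ((M - (1 - l) * (u \<bullet> p)) * V) = integral (?h ` K) ?g"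
      using integral_homothetic_image[OF compact_imp_bounded[OF cK] l(1) gint[OF ch]] gh by simp
    also have "\<dots> \<le> integral K ?g"
      by (rule integral_subset_le[OF sub gint[OF ch] gint[OF cK]]) (use M in auto)
    finally have "(l ^ ?n * (M - (1 - l) * (u \<bullet> p))) * V \<le> M * V"
      using gK by (simp add: mult.assoc)
    then have "l ^ ?n * (M - (1 - l) * (u \<bullet> p)) \<le> M"
      using V by simp
    then have "(1 - l) * (- (u \<bullet> p) * l ^ ?n) \<le> M * (1 - l ^ ?n)"
      by (simp add: algebra_simps)
    also have "\<dots> = (1 - l) * (M * (\<Sum>i<?n. l ^ i))"
      by (simp add: one_diff_power_eq)
    finally show ?thesis using l(2) by (simp only: mult_le_cancel_left_pos diff_gt_0_iff_gt)
  qed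
  have "((\<lambda>l::real. - (u \<bullet> p) * l ^ ?n) \<longlongrightarrow> - (u \<bullet> p) * 1 ^ ?n) (at_left 1)"
    by (intro tendsto_intros)
  moreover have "((\<lambda>l::real. M * (\<Sum>i<?n. l ^ i)) \<longlongrightarrow> M * (\<Sum>i<?n. 1 ^ i)) (at_left 1)"
    by (intro tendsto_intros)
  moreover have "eventually (\<lambda>l::real. - (u \<bullet> p) * l ^ ?n \<le> M * (\<Sum>i<?n. l ^ i)) (at_left 1)"
    unfolding eventually_at_left_field using main by (intro exI[of _ 0]) simp
  ultimately have "- (u \<bullet> p) * 1 ^ ?n \<le> M * (\<Sum>i<?n. 1 ^ i)"
    by (intro tendsto_le[of "at_left (1::real)"]) auto
  then show ?thesis by (simp add: algebra_simps)
qed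

corollary zero_in_body_with_barycenter_zero:
  fixes K :: "'a::euclidean_space set"
  assumes K: "convex_body K" and b0: "barycenter K = 0"
  shows "0 \<in> K"
proof (rule ccontr)
  assume "0 \<notin> K"
  moreover have "convex K" "closed K" "K \<noteq> {}"
    using K by (auto simp: convex_body_def compact_imp_closed)
  ultimately obtain v b where b: "v \<bullet> 0 < b" "\<forall>x\<in>K. v \<bullet> x > b"
    using separating_hyperplane_closed_point by blast
  obtain p where p: "p \<in> K" using \<open>K \<noteq> {}\<close> by blast
  have "- (real DIM('a) * (- b)) \<le> (- v) \<bullet> p"
    by (rule barycenter_functional_lower_bound[OF K b0 p]) (use b in \<open>auto intro: less_imp_le\<close>)
  moreover have "0 \<le> real DIM('a) * b" using b by simp
  ultimately show False using b p by fastforce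
qed

section \<open>Stretching a ball towards an outside point\<close>

text \<open>
  The ellipsoid has semi-axis \<open>1 + q (t - 1)\<close> in the direction \<open>u\<close> and \<open>sqrt (1 - 2 q)\<close> orthogonally to
  it, and centre \<open>q (t - 1) u\<close>. These values make it touch the hull of the ball and \<open>t u\<close> at the point \<open>- u\<close>
  and along the sphere of tangency of the cone. In terms of support functions, with \<open>N\<close> the norm of
  a direction \<open>v\<close> and \<open>s = v \<bullet> u\<close>, the containment follows from two factorisations, one for each of the
  two values \<open>N\<close> and \<open>t s\<close> that the support function of the hull can take.
\<close>

lemma stretched_ball_subset:
  fixes L :: "'a::euclidean_space set"
  assumes L: "closed L" "convex L" "cball 0 1 \<subseteq> L" "t *\<^sub>R u \<in> L"
    and u: "norm u = 1" and t: "t > 1" and q: "0 \<le> q" "q \<le> 1/2" and y: "norm y \<le> 1"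
  defines "\<beta> \<equiv> sqrt (1 - 2 * q)" and "e \<equiv> q * (t - 1)"
  shows "\<beta> *\<^sub>R y + ((1 + e - \<beta>) * (u \<bullet> y)) *\<^sub>R u + e *\<^sub>R u \<in> L"
    (is "?z \<in> L")
proof (rule ccontr)
  assume "?z \<notin> L"
  then obtain a b where ab: "a \<bullet> ?z < b" "\<And>x. x \<in> L \<Longrightarrow> b < a \<bullet> x"
    using separating_hyperplane_closed_point[OF L(2,1)] by blast
  define v where "v = - a"
  define N where "N = norm v"
  define s where "s = v \<bullet> u"
  define w where "w = \<beta> *\<^sub>R v + ((1 + e - \<beta>) * s) *\<^sub>R u"
  have \<beta>2: "\<beta>\<^sup>2 = 1 - 2 * q" using q by (simp add: \<beta>_def)
  have e0: "e \<ge> 0" using q t by (simp add: e_def)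
  have "q * (t - 1) \<le> 1 * (t - 1)" using q t by (intro mult_right_mono) auto
  then have et: "e \<le> t" by (simp add: e_def)
  have vL: "v \<bullet> x < - b" if "x \<in> L" for x
    using ab(2)[OF that] by (simp add: v_def)
  have Nb: "N < - b"
  proof -
    have "sgn v \<in> L" using L(3) by (auto simp: norm_sgn)
    moreover have "v \<bullet> sgn v = N"
      by (cases "v = 0")
         (simp_all add: sgn_div_norm N_def power2_norm_eq_inner[symmetric] power2_eq_square)
    ultimately show ?thesis using vL by metis
  qed
  have tsb: "t * s < - b" using vL[OF L(4)] by (simp add: s_def)
  have sN: "\<bar>s\<bar> \<le> N"
    using Cauchy_Schwarz_ineq2[of v u] u by (simp add: s_def N_def)
  have N0: "N \<ge> 0" by (simp add: N_def)
  have uu: "u \<bullet> u = 1" using u by (simp add: power2_norm_eq_inner[symmetric])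
  have w2: "(norm w)\<^sup>2 = (1 - 2 * q) * N\<^sup>2 + ((1 + e)\<^sup>2 - (1 - 2 * q)) * s\<^sup>2"
  proof -
    have "(norm w)\<^sup>2 = \<beta>\<^sup>2 * (v \<bullet> v) + 2 * \<beta> * ((1 + e - \<beta>) * s) * (v \<bullet> u)
        + ((1 + e - \<beta>) * s)\<^sup>2 * (u \<bullet> u)"
      unfolding power2_norm_eq_inner w_def
      by (simp add: inner_simps inner_commute power2_eq_square algebra_simps)
    also have "\<dots> = \<beta>\<^sup>2 * N\<^sup>2 + ((1 + e)\<^sup>2 - \<beta>\<^sup>2) * s\<^sup>2"
      unfolding uu s_def[symmetric] N_def power2_norm_eq_inner
      by (simp add: power2_eq_square algebra_simps)
    finally show ?thesis by (simp add: \<beta>2)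
  qed
  have "v \<bullet> ?z = w \<bullet> y + e * s"
    by (simp add: w_def s_def inner_simps inner_commute algebra_simps)
  also have "w \<bullet> y \<le> norm w"
    using Cauchy_Schwarz_ineq2[of w y] y mult_left_mono[OF y, of "norm w"] by simp
  finally have vz: "v \<bullet> ?z \<le> norm w + e * s" by simp
  have "norm w + e * s \<le> max N (t * s)"
  proof (cases "t * s \<le> N")
    case True
    have "e * s \<le> N"
    proof (cases "s \<ge> 0")
      case True
      have "e * s \<le> t * s" using et True by (rule mult_right_mono)
      then show ?thesis using \<open>t * s \<le> N\<close> by simp
    next
      case False
      then have "e * s \<le> 0" using e0 by (simp add: mult_nonneg_nonpos)
      then show ?thesis using N0 by simp
    qed
    moreover have "(N - e * s)\<^sup>2 - (norm w)\<^sup>2 = 2 * q * (N + s) * (N - t * s)"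
      unfolding w2 e_def by (simp add: power2_eq_square algebra_simps)
    moreover have "2 * q * (N + s) * (N - t * s) \<ge> 0"
      using q sN True by (intro mult_nonneg_nonneg) auto
    ultimately have "(norm w)\<^sup>2 \<le> (N - e * s)\<^sup>2" "0 \<le> N - e * s" by linarith+
    then have "norm w \<le> N - e * s" by (rule power2_le_imp_le)
    then show ?thesis by simp
  next
    case False
    then have ts: "t * s > N" by simp
    then have s0: "s > 0" using N0 t by (smt (verit) mult_nonneg_nonpos)
    have "0 \<le> t * s - e * s" using s0 et by (simp add: mult_right_mono)
    moreover have "(t * s - e * s)\<^sup>2 - (norm w)\<^sup>2 = (1 - 2 * q) * ((t * s)\<^sup>2 - N\<^sup>2)"
      unfolding w2 e_def by (simp add: power2_eq_square algebra_simps)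
    moreover have "(1 - 2 * q) * ((t * s)\<^sup>2 - N\<^sup>2) \<ge> 0"
      using q power_mono[of N "t * s" 2] ts N0 by (intro mult_nonneg_nonneg) linarith+
    ultimately have "(norm w)\<^sup>2 \<le> (t * s - e * s)\<^sup>2" "0 \<le> t * s - e * s" by linarith+
    then have "norm w \<le> t * s - e * s" by (rule power2_le_imp_le)
    then show ?thesis by simp
  qed
  then have "v \<bullet> ?z < - b" using vz Nb tsb by linarith
  then show False using ab(1) by (simp add: v_def)
qed

text \<open>
  To first order in \<open>q\<close> the square of the volume ratio is \<open>1 + 2 q (t - 1) - 2 q (n - 1) = 1 + 2 q (t - n)\<close>,
  so \<open>t > n\<close> is the condition for a gain. Bernoulli's inequality bounds it from below by
  \<open>(1 + 2 q (t - 1)) (1 - 2 q (n - 1))\<close>, which differs from the first-order expression by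
  \<open>4 q\<^sup>2 (t - 1) (n - 1)\<close>; the explicit \<open>q\<close> makes this less than \<open>2 q (t - n)\<close>.
\<close>

lemma stretching_gains_volume:
  fixes t :: real
  assumes n: "n \<ge> 1" and t: "t > real n"
  obtains q where "0 < q" "q \<le> 1/2" "(1 + q * (t - 1)) * sqrt (1 - 2 * q) ^ (n - 1) > 1"
proof
  define q where "q = (t - n) / (2 * n * (t - 1))"
  have n1: "real n \<ge> 1" using n by simp
  have t1: "t > 1" using n1 t by linarith
  show q0: "0 < q" using n1 t t1 by (simp add: q_def)
  have qt: "2 * q * (t - 1) = (t - n) / n"
    using n1 t1 by (simp add: q_def field_simps)
  have "t - n \<le> t - 1" using n1 by simp
  also have "t - 1 \<le> n * (t - 1)"
    using mult_right_mono[OF n1, of "t - 1"] less_imp_le[OF t1] by (simp only: mult_1 diff_ge_0_iff_ge)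
  finally show q2: "q \<le> 1/2" using n1 t1 by (simp add: q_def field_simps)
  have "((1 + q * (t - 1)) * sqrt (1 - 2 * q) ^ (n - 1))\<^sup>2
      = (1 + q * (t - 1))\<^sup>2 * (sqrt (1 - 2 * q) ^ 2) ^ (n - 1)"
    by (simp add: power_mult_distrib power_mult[symmetric] mult.commute)
  also have "\<dots> = (1 + q * (t - 1))\<^sup>2 * (1 - 2 * q) ^ (n - 1)"
    using q2 by simp
  also have "\<dots> \<ge> (1 + 2 * q * (t - 1)) * (1 - 2 * q * (real n - 1))"
  proof -
    have "1 + real (n - 1) * (- 2 * q) \<le> (1 + (- 2 * q)) ^ (n - 1)"
      using q2 by (intro Bernoulli_inequality) auto
    then have "1 - 2 * q * (real n - 1) \<le> (1 - 2 * q) ^ (n - 1)"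
      using n by (simp add: of_nat_diff algebra_simps)
    moreover have "1 + 2 * q * (t - 1) \<le> (1 + q * (t - 1))\<^sup>2"
      using zero_le_power2[of "q * (t - 1)"] by (simp only: power2_sum) simp
    moreover have "0 \<le> 1 + 2 * q * (t - 1)" using q0 t1 by simp
    ultimately have "(1 + 2 * q * (t - 1)) * (1 - 2 * q * (real n - 1))
       \<le> (1 + 2 * q * (t - 1)) * (1 - 2 * q) ^ (n - 1)"
      "(1 + 2 * q * (t - 1)) * (1 - 2 * q) ^ (n - 1) \<le> (1 + q * (t - 1))\<^sup>2 * (1 - 2 * q) ^ (n - 1)"
      using q2 by (auto intro!: mult_left_mono mult_right_mono)
    then show ?thesis by linarith
  qed
  also have "(1 + 2 * q * (t - 1)) * (1 - 2 * q * (real n - 1))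
      = 1 + 2 * q * ((t - n) - (2 * q * (t - 1)) * (n - 1))"
    using n by (simp add: of_nat_diff algebra_simps)
  also have "\<dots> = 1 + 2 * q * ((t - n) / n)"
    unfolding qt using n n1 by (simp add: of_nat_diff field_simps)
  finally have "1 + 2 * q * ((t - n) / n) \<le> ((1 + q * (t - 1)) * sqrt (1 - 2 * q) ^ (n - 1))\<^sup>2" .
  moreover have "2 * q * ((t - n) / n) > 0" using q0 t n1 by simp
  ultimately have "1\<^sup>2 < ((1 + q * (t - 1)) * sqrt (1 - 2 * q) ^ (n - 1))\<^sup>2" by simp
  moreover have "0 \<le> (1 + q * (t - 1)) * sqrt (1 - 2 * q) ^ (n - 1)"
    using q0 q2 t1 by simp
  ultimately show "(1 + q * (t - 1)) * sqrt (1 - 2 * q) ^ (n - 1) > 1"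
    by (rule power_less_imp_less_base)
qed

text \<open>
  The stretching map as a matrix: up to a rotation moving a coordinate axis to \<open>u\<close>, it is
  diagonal, which gives its determinant.
\<close>

lemma stretching_matrix:
  fixes u :: "real ^ 'n"
  assumes u: "norm u = 1"
  obtains S :: "real ^ 'n ^ 'n"
  where "\<bar>det S\<bar> = \<bar>\<alpha> * \<beta> ^ (CARD('n) - 1)\<bar>"
    and "\<And>y. norm y \<le> 1 \<Longrightarrow>
      \<exists>y'. norm y' \<le> 1 \<and> S *v y = \<beta> *\<^sub>R y' + ((\<alpha> - \<beta>) * (u \<bullet> y')) *\<^sub>R u"
proof -
  fix k :: 'n
  obtain Q :: "real ^ 'n ^ 'n" where Q: "orthogonal_matrix Q" and Qk: "Q *v axis k 1 = u"
    using orthogonal_matrix_exists_basis[OF u] by metis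
  have Qt: "orthogonal_transformation ((*v) Q)"
    using Q by (simp add: orthogonal_transformation_matrix)
  define D :: "real ^ 'n ^ 'n"
    where "D = (\<chi> i j. if i = j then (if i = k then \<alpha> else \<beta>) else 0)"
  have "det D = (\<Prod>i\<in>UNIV. if i = k then \<alpha> else \<beta>)"
    by (subst det_diagonal) (auto simp: D_def)
  also have "\<dots> = \<alpha> * \<beta> ^ (CARD('n) - 1)"
    by (subst prod.remove[of _ k]) (auto simp: prod.If_cases card_Diff_singleton)
  finally have detD: "det D = \<alpha> * \<beta> ^ (CARD('n) - 1)" .
  show thesis
  proof
    have "\<bar>det Q\<bar> = 1" using det_orthogonal_matrix[OF Q] by auto
    then show "\<bar>det (Q ** D)\<bar> = \<bar>\<alpha> * \<beta> ^ (CARD('n) - 1)\<bar>"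
      by (simp add: det_mul abs_mult detD)
  next
    fix y :: "real ^ 'n" assume y: "norm y \<le> 1"
    have Dy: "D *v y = \<beta> *\<^sub>R y + ((\<alpha> - \<beta>) * (y $ k)) *\<^sub>R axis k 1"
    proof -
      have "(D *v y) $ i = (if i = k then \<alpha> else \<beta>) * y $ i" for i
        by (simp add: D_def matrix_vector_mult_def if_distrib[where f="\<lambda>x. x * _"] cong: if_cong)
      then show ?thesis by (auto simp: vec_eq_iff axis_def algebra_simps)
    qed
    have "u \<bullet> (Q *v y) = axis k 1 \<bullet> y"
      using Qt unfolding Qk[symmetric] orthogonal_transformation_def by blast
    then have uy: "u \<bullet> (Q *v y) = y $ k" by (simp add: inner_axis')
    have "(Q ** D) *v y = \<beta> *\<^sub>R (Q *v y) + ((\<alpha> - \<beta>) * (u \<bullet> (Q *v y))) *\<^sub>R u"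
      unfolding matrix_vector_mul_assoc[symmetric] Dy uy
      by (simp add: matrix_vector_right_distrib matrix_vector_mult_scaleR Qk)
    moreover have "norm (Q *v y) \<le> 1"
      using y orthogonal_transformation_norm[OF Qt] by simp
    ultimately show "\<exists>y'. norm y' \<le> 1 \<and> (Q ** D) *v y = \<beta> *\<^sub>R y' + ((\<alpha> - \<beta>) * (u \<bullet> y')) *\<^sub>R u"
      by blast
  qed
qed

section \<open>The ellipsoid of maximal volume\<close>

definition inscribed_ellipsoids :: "(real ^ 'n) set \<Rightarrow> ((real ^ 'n ^ 'n) \<times> (real ^ 'n)) set" where
  "inscribed_ellipsoids K = {(T, c). \<forall>y. norm y \<le> 1 \<longrightarrow> T *v y + c \<in> K}"

lemma compact_inscribed_ellipsoids:
  fixes K :: "(real ^ 'n) set"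
  assumes K: "compact K"
  shows "compact (inscribed_ellipsoids K)"
proof -
  have "inscribed_ellipsoids K = (\<Inter>y\<in>cball 0 1. (\<lambda>p. fst p *v y + snd p) -` K)"
    by (auto simp: inscribed_ellipsoids_def)
  moreover have "closed ((\<lambda>p::(real ^ 'n ^ 'n) \<times> (real ^ 'n). fst p *v y + snd p) -` K)" for y
    unfolding matrix_vector_mult_def
    by (intro closed_vimage compact_imp_closed[OF K] continuous_intros)
  ultimately have cl: "closed (inscribed_ellipsoids K)"
    by (simp add: closed_INT)
  obtain R where R: "\<And>x. x \<in> K \<Longrightarrow> norm x \<le> R"
    using compact_imp_bounded[OF K] by (auto simp: bounded_iff)
  have "norm p \<le> real CARD('n) * (real CARD('n) * (2 * R)) + R" if "p \<in> inscribed_ellipsoids K" for p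
  proof -
    obtain T c where p: "p = (T, c)" by (cases p)
    have Tc: "T *v y + c \<in> K" if "norm y \<le> 1" for y
      using \<open>p \<in> _\<close> that by (simp add: p inscribed_ellipsoids_def)
    have c: "norm c \<le> R" using R[OF Tc[of 0]] by simp
    have entry: "\<bar>T $ i $ j\<bar> \<le> 2 * R" for i j
    proof -
      have "\<bar>T $ i $ j\<bar> = \<bar>(T *v axis j 1) $ i\<bar>"
        by (simp add: matrix_vector_mul_component inner_axis)
      also have "\<dots> \<le> norm (T *v axis j 1)" by (rule component_le_norm_cart)
      also have "\<dots> \<le> norm (T *v axis j 1 + c) + norm c"
        by (metis add_diff_cancel_right' norm_triangle_ineq4)
      also have "\<dots> \<le> R + R" using R[OF Tc[of "axis j 1"]] c by simp
      finally show ?thesis by simp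
    qed
    have "norm (T $ i) \<le> real CARD('n) * (2 * R)" for i
      using norm_le_l1_cart[of "T $ i"] sum_bounded_above[of UNIV "\<lambda>j. \<bar>T $ i $ j\<bar>" "2 * R"] entry
      by fastforce
    then have "norm T \<le> real CARD('n) * (real CARD('n) * (2 * R))"
      using L2_set_le_sum[of UNIV "\<lambda>i. norm (T $ i)"]
        sum_bounded_above[of UNIV "\<lambda>i. norm (T $ i)" "real CARD('n) * (2 * R)"]
      by (fastforce simp: norm_vec_def)
    then show ?thesis
      using c norm_Pair_le[of T c] by (simp add: p)
  qed
  then have "bounded (inscribed_ellipsoids K)" unfolding bounded_iff by blast
  then show ?thesis using cl by (simp add: compact_eq_bounded_closed)
qed

text \<open>
  A pair \<open>(T, c)\<close> with maximal determinant describes the maximal ellipsoid. In the coordinates \<open>w\<close>,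
  in which this ellipsoid is the unit ball, a point of the body at distance more than \<open>n\<close> would give
  a larger ellipsoid by stretching.
\<close>

theorem John_position:
  fixes K :: "(real ^ 'n) set"
  assumes K: "convex_body K"
  obtains T :: "real ^ 'n ^ 'n" and c :: "real ^ 'n"
  where "invertible T" and "\<And>y. norm y \<le> 1 \<Longrightarrow> T *v y + c \<in> K"
    and "\<And>w. T *v w + c \<in> K \<Longrightarrow> norm w \<le> real CARD('n)"
proof -
  have cK: "compact K" and vK: "convex K" and iK: "interior K \<noteq> {}"
    using K by (auto simp: convex_body_def)
  \<comment> \<open>a small ball, so that the maximal determinant is nonzero\<close>
  obtain p d where d: "d > 0" "cball p d \<subseteq> K"
    using iK mem_interior_cball by blast
  have small: "(mat d, p) \<in> inscribed_ellipsoids K"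
  proof -
    have "mat d *v y + p \<in> K" if y: "norm y \<le> 1" for y :: "real ^ 'n"
    proof -
      have "mat d *v y = d *\<^sub>R y"
        by (simp add: vec_eq_iff mat_def matrix_vector_mult_def if_distrib[where f="\<lambda>x. x * _"]
            cong: if_cong)
      then have "mat d *v y + p \<in> cball p d"
        using y d(1) by (simp add: dist_norm mult_left_le)
      then show ?thesis using d(2) by blast
    qed
    then show ?thesis by (simp add: inscribed_ellipsoids_def)
  qed
  have "continuous_on (inscribed_ellipsoids K) (\<lambda>x. \<bar>det (fst x)\<bar>)"
    unfolding det_def by (intro continuous_intros)
  then obtain T c where Tc: "(T, c) \<in> inscribed_ellipsoids K"
    and max: "\<And>T' c'. (T', c') \<in> inscribed_ellipsoids K \<Longrightarrow> \<bar>det T'\<bar> \<le> \<bar>det T\<bar>"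
    using continuous_attains_sup[OF compact_inscribed_ellipsoids[OF cK], of "\<lambda>x. \<bar>det (fst x)\<bar>"] small
    by (metis empty_iff fst_conv surj_pair)
  have "det (mat d :: real ^ 'n ^ 'n) = d ^ CARD('n)"
    by (subst det_diagonal) (auto simp: mat_def)
  then have detT: "det T \<noteq> 0"
    using max[OF small] zero_less_power[OF d(1), of "CARD('n)"] by auto
  show thesis
  proof
    show "invertible T" using detT by (simp add: invertible_det_nz)
    show TcK: "T *v y + c \<in> K" if "norm y \<le> 1" for y
      using Tc that by (simp add: inscribed_ellipsoids_def)
    fix w assume w: "T *v w + c \<in> K"
    show "norm w \<le> real CARD('n)"
    proof (rule ccontr)
      define t where "t = norm w"
      define u where "u = w /\<^sub>R t"
      assume "\<not> norm w \<le> real CARD('n)"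
      then have t: "t > real CARD('n)" by (simp add: t_def)
      have "real CARD('n) \<ge> 1" by (simp add: Suc_leI)
      then have t1: "t > 1" using t by linarith
      have tu: "t *\<^sub>R u = w" using t1 by (simp add: u_def)
      have "w \<noteq> 0" using t1 by (auto simp: t_def)
      then have u: "norm u = 1" by (simp add: u_def t_def)
      obtain q where q: "0 < q" "q \<le> 1/2"
        and gain: "(1 + q * (t - 1)) * sqrt (1 - 2 * q) ^ (CARD('n) - 1) > 1"
        using stretching_gains_volume[OF _ t] by (auto simp: Suc_leI)
      define e where "e = q * (t - 1)"
      define \<beta> where "\<beta> = sqrt (1 - 2 * q)"
      obtain S :: "real ^ 'n ^ 'n" where detS: "\<bar>det S\<bar> = \<bar>(1 + e) * \<beta> ^ (CARD('n) - 1)\<bar>"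
        and S: "\<And>y. norm y \<le> 1 \<Longrightarrow>
          \<exists>y'. norm y' \<le> 1 \<and> S *v y = \<beta> *\<^sub>R y' + ((1 + e - \<beta>) * (u \<bullet> y')) *\<^sub>R u"
        using stretching_matrix[OF u] by metis
      define L where "L = (\<lambda>w. T *v w + c) -` K"
      have "closed L" unfolding L_def
        by (intro closed_vimage compact_imp_closed[OF cK] continuous_intros)
      moreover have "convex L"
      proof -
        have "T *v (a *\<^sub>R x + b *\<^sub>R y) + c = a *\<^sub>R (T *v x + c) + b *\<^sub>R (T *v y + c)"
          if "a + b = 1" for a b x y
        proof -
          have "a *\<^sub>R c + b *\<^sub>R c = c" using that by (metis scaleR_left_distrib scaleR_one)
          then show ?thesis
            by (simp add: matrix_vector_right_distrib matrix_vector_mult_scaleR algebra_simps)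
        qed
        then show ?thesis
          using vK unfolding L_def convex_def by simp
      qed
      moreover have "cball 0 1 \<subseteq> L" using TcK by (auto simp: L_def)
      moreover have "t *\<^sub>R u \<in> L" using w tu by (simp add: L_def)
      ultimately have stretched: "\<beta> *\<^sub>R y + ((1 + e - \<beta>) * (u \<bullet> y)) *\<^sub>R u + e *\<^sub>R u \<in> L"
        if "norm y \<le> 1" for y
        unfolding e_def \<beta>_def using u t1 q that by (intro stretched_ball_subset) auto
      have "(T ** S) *v y + (T *v (e *\<^sub>R u) + c) \<in> K" if y: "norm y \<le> 1" for y
      proof -
        have "S *v y + e *\<^sub>R u \<in> L" using S[OF y] stretched by auto
        then show ?thesis
          by (simp add: L_def matrix_vector_mul_assoc[symmetric] matrix_vector_right_distrib add.assoc)
      qed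
      then have "(T ** S, T *v (e *\<^sub>R u) + c) \<in> inscribed_ellipsoids K"
        by (simp add: inscribed_ellipsoids_def)
      from max[OF this] have "\<bar>det T\<bar> * \<bar>det S\<bar> \<le> \<bar>det T\<bar> * 1"
        by (simp add: det_mul abs_mult)
      then have "\<bar>det S\<bar> \<le> 1" using mult_le_cancel_left_pos[of "\<bar>det T\<bar>"] detT by simp
      then show False using detS gain unfolding e_def \<beta>_def by linarith
    qed
  qed
qed

section \<open>Position of the body and of its polar\<close>

theorem lemma37:
  fixes K :: "(real ^ 'n) set"
  assumes "convex_body K" and "barycenter K = 0"
  shows "\<exists>(A :: real ^ 'n ^ 'n) (r :: real) (a :: real ^ 'n).
    invertible A \<and> r > 0 \<and> a \<in> (\<lambda>x. A *v x) ` K \<and>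
    cball a r \<subseteq> (\<lambda>x. A *v x) ` K \<and>
    (\<lambda>x. A *v x) ` K \<subseteq> cball 0 (2 * real CARD('n) * r) \<and>
    polar ((\<lambda>x. A *v x) ` K) \<subseteq> cball 0 (2 * real CARD('n) / r)"
proof -
  let ?n = "real CARD('n)"
  have n1: "?n \<ge> 1" by (simp add: Suc_leI)
  obtain T :: "real ^ 'n ^ 'n" and c where T: "invertible T"
    and ball: "\<And>y. norm y \<le> 1 \<Longrightarrow> T *v y + c \<in> K"
    and John: "\<And>w. T *v w + c \<in> K \<Longrightarrow> norm w \<le> ?n"
    using John_position[OF assms(1)] by metis
  define A where "A = matrix_inv T"
  define a where "a = A *v c"
  have AT: "A ** T = mat 1" and TA: "T ** A = mat 1"
    using someI_ex[OF T[unfolded invertible_def]] by (simp_all add: A_def matrix_inv_def)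
  have invA: "invertible A" using AT TA by (auto simp: invertible_def)
  have ATv: "A *v (T *v y) = y" for y by (simp add: matrix_vector_mul_assoc AT)
  have TAv: "T *v (A *v y) = y" for y by (simp add: matrix_vector_mul_assoc TA)
  have inner_ball: "cball a 1 \<subseteq> (\<lambda>x. A *v x) ` K"
  proof
    fix z assume "z \<in> cball a 1"
    then have "T *v (z - a) + c \<in> K" by (intro ball) (simp add: dist_norm norm_minus_commute)
    moreover have "z = A *v (T *v (z - a) + c)"
      by (simp add: matrix_vector_right_distrib ATv a_def)
    ultimately show "z \<in> (\<lambda>x. A *v x) ` K" by blast
  qed
  have cK: "c \<in> K" using ball[of 0] by simp
  have dist_a: "norm (A *v x - a) \<le> ?n" if "x \<in> K" for x
    using that by (intro John) (simp add: matrix_vector_mult_diff_distrib TAv a_def)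
  have na: "norm a \<le> ?n"
    using dist_a[OF zero_in_body_with_barycenter_zero[OF assms]] by simp
  have outer: "(\<lambda>x. A *v x) ` K \<subseteq> cball 0 (2 * ?n)"
  proof clarify
    fix x assume "x \<in> K"
    then have "norm (A *v x - a) + norm a \<le> 2 * ?n" using dist_a na by fastforce
    then show "A *v x \<in> cball 0 (2 * ?n)"
      using norm_triangle_ineq[of "A *v x - a" a] by simp
  qed
  have polar: "polar ((\<lambda>x. A *v x) ` K) \<subseteq> cball 0 (2 * ?n)"
  proof
    fix y assume "y \<in> polar ((\<lambda>x. A *v x) ` K)"
    then have y: "(A *v x) \<bullet> y \<le> 1" if "x \<in> K" for x
      using that by (auto simp: polar_def)
    have adj: "(y v* A) \<bullet> x = (A *v x) \<bullet> y" for x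
      unfolding dot_lmul_matrix by (rule inner_commute)
    have "- (real DIM(real ^ 'n) * 1) \<le> (y v* A) \<bullet> c"
      by (rule barycenter_functional_lower_bound[OF assms cK]) (simp add: adj y)
    then have low: "- ?n \<le> a \<bullet> y" by (simp add: adj a_def)
    have "a + sgn y \<in> (\<lambda>x. A *v x) ` K"
      using inner_ball by (auto simp: dist_norm norm_sgn)
    then have "(a + sgn y) \<bullet> y \<le> 1" using y by auto
    moreover have "sgn y \<bullet> y = norm y"
      by (cases "y = 0")
         (simp_all add: sgn_div_norm power2_norm_eq_inner[symmetric] power2_eq_square)
    ultimately have "norm y \<le> 1 + ?n" using low by (simp add: inner_add_left)
    then show "y \<in> cball 0 (2 * ?n)" using n1 unfolding mem_cball_0 by linarith
  qed
  show ?thesis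
    by (rule exI[of _ A], rule exI[of _ 1], rule exI[of _ a])
       (use invA inner_ball outer polar cK in \<open>auto simp: a_def\<close>)
qed

end
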